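(* Let $\varepsilon>0$, $\beta\ge0$, $\Delta t>0$, and consider the isotropic Cahn--Hilliard equation $u_t=\Delta\mu$, $\mu=-\Delta u+\varepsilon^{-2}F'(u)+\beta\Delta^2u$ with periodic boundary conditions and $F(u)=\frac14(u^2-1)^2$. Let $(U^n,Q^n)$, $(U^{n+1},Q^{n+1})$ and $\mu^{n+\frac12}$ be grid functions satisfying the fully discrete scheme $$\begin{aligned} \delta_tU^{n+1}&=\Delta_h\mu^{n+\frac12},\\ \mu^{n+\frac12}&=-\Delta_hU^{n+\frac12}+2\varepsilon^{-2}U^{n+\frac12}\odot Q^{n+\frac12}+\beta\Delta_h^2U^{n+\frac12},\\ \delta_tQ^{n+1}&=U^{n+\frac12}\odot\delta_tU^{n+1}, \end{aligned}$$ with $Q^n=\frac12\bigl((U^n)^{\odot2}-1\bigr)$. Then the scheme preserves the dissipative property $$E_{\mathrm{iso},h}(U^{n+1})\le E_{\mathrm{iso},h}(U^n),$$ where $$E_{\mathrm{iso},h}(U)=-\tfrac12(\Delta_hU,U)_h+\varepsilon^{-2}(F(U),\mathbf 1)_h+\tfrac\beta2\|\Delta_hU\|_h^2.$$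
   Context: $\Omega=[a_x,b_x]\times[a_y,b_y]$ with uniform grid $\Omega_h=\{(x_j,y_k):x_j=a_x+jh_x,\ y_k=a_y+kh_y\}$, $0\le j<N_x$, $0\le k<N_y$, $h_x=(b_x-a_x)/N_x$, $h_y=(b_y-a_y)/N_y$, with $N_x,N_y$ even. $V_h$ is the space of real grid functions $U=(U_{jk})$, regarded as $N_x\times N_y$ matrices. $D_x\in\mathbb{R}^{N_x\times N_x}$ and $D_y\in\mathbb{R}^{N_y\times N_y}$ are the first-order Fourier pseudo-spectral differentiation matrices; for period $L$ and $N$ nodes the entries are $D_{jl}=\frac{\pi}{L}(-1)^{j+l}\cot\frac{\pi(j-l)}{N}$ for $j\ne l$ and $D_{jj}=0$ (these matrices are real and skew-symmetric). The discrete Laplacian is $\Delta_hU=D_x^2U+U(D_y^\top)^2$. $\odot$ is the entrywise (Hadamard) product, $U^{\odot2}=U\odot U$, and $\mathbf 1$ is the grid function with all entries $1$. $(U,V)_h=h_xh_y\sum_{j,k}U_{jk}V_{jk}$, $\|U\|_h^2=(U,U)_h$, and $F(U)$ is taken entrywise. For a sequence $Z^n$: $\delta_tZ^{n+1}=\frac{Z^{n+1}-Z^n}{\Delta t}$ and $Z^{n+\frac12}=\frac{Z^{n+1}+Z^n}2$. *)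

theory Defs
  imports Complex_Main "Jordan_Normal_Form.Matrix"
begin

text \<open>
  A uniform grid with \<open>xnum * ynum\<close> nodes on the rectangle \<open>[xlo, xhi] \<times> [ylo, yhi]\<close>. Real grid
  functions \<open>U\<close> are \<open>xnum \<times> ynum\<close> matrices; \<open>U $$ (j, k)\<close> is the value at the node
  \<open>(xlo + j * hx, ylo + k * hy)\<close>.
\<close>

record grid =
  xlo :: real
  xhi :: real
  ylo :: real
  yhi :: real
  xnum :: nat
  ynum :: nat

definition valid_grid :: "grid \<Rightarrow> bool" where
  "valid_grid g \<longleftrightarrow> xlo g < xhi g \<and> ylo g < yhi g
     \<and> 0 < xnum g \<and> even (xnum g) \<and> 0 < ynum g \<and> even (ynum g)"

definition hx :: "grid \<Rightarrow> real" where
  "hx g = (xhi g - xlo g) / real (xnum g)"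

definition hy :: "grid \<Rightarrow> real" where
  "hy g = (yhi g - ylo g) / real (ynum g)"

definition grid_functions :: "grid \<Rightarrow> real mat set" where
  "grid_functions g = carrier_mat (xnum g) (ynum g)"

definition grid_one :: "grid \<Rightarrow> real mat" where
  "grid_one g = mat (xnum g) (ynum g) (\<lambda>_. 1)"

definition fourier_diff :: "real \<Rightarrow> nat \<Rightarrow> real mat" where
  "fourier_diff L N = mat N N (\<lambda>(j, l).
     if j = l then 0
     else pi / L * (-1) ^ (j + l) * cot (pi * (real j - real l) / real N))"

definition Dx :: "grid \<Rightarrow> real mat" where
  "Dx g = fourier_diff (xhi g - xlo g) (xnum g)"

definition Dy :: "grid \<Rightarrow> real mat" where
  "Dy g = fourier_diff (yhi g - ylo g) (ynum g)"

definition laplace_h :: "grid \<Rightarrow> real mat \<Rightarrow> real mat" where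
  "laplace_h g U = (Dx g ^\<^sub>m 2) * U + U * ((Dy g)\<^sup>T ^\<^sub>m 2)"

definition hadamard :: "real mat \<Rightarrow> real mat \<Rightarrow> real mat" (infixl "\<odot>" 70) where
  "A \<odot> B = mat (dim_row A) (dim_col A) (\<lambda>ij. A $$ ij * B $$ ij)"

definition inner_h :: "grid \<Rightarrow> real mat \<Rightarrow> real mat \<Rightarrow> real" where
  "inner_h g U V = hx g * hy g * (\<Sum>j<xnum g. \<Sum>k<ynum g. U $$ (j, k) * V $$ (j, k))"

definition norm_h :: "grid \<Rightarrow> real mat \<Rightarrow> real" where
  "norm_h g U = sqrt (inner_h g U U)"

text \<open>
  The index \<open>n\<close> is the lower time level: \<open>delta_t dt Z n\<close> is the quotient usually written with
  superscript \<open>n + 1\<close>, and \<open>midpoint Z n\<close> is the average with superscript \<open>n + 1/2\<close>.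
\<close>

definition delta_t :: "real \<Rightarrow> (nat \<Rightarrow> real mat) \<Rightarrow> nat \<Rightarrow> real mat" where
  "delta_t dt Z n = (1 / dt) \<cdot>\<^sub>m (Z (n + 1) - Z n)"

definition midpoint :: "(nat \<Rightarrow> real mat) \<Rightarrow> nat \<Rightarrow> real mat" where
  "midpoint Z n = (1 / 2) \<cdot>\<^sub>m (Z (n + 1) + Z n)"

definition double_well :: "real \<Rightarrow> real" where
  "double_well u = 1 / 4 * (u\<^sup>2 - 1)\<^sup>2"

definition energy_iso_h :: "grid \<Rightarrow> real \<Rightarrow> real \<Rightarrow> real mat \<Rightarrow> real" where
  "energy_iso_h g \<epsilon> \<beta> U =
     - (1 / 2) * inner_h g (laplace_h g U) U
     + 1 / \<epsilon>\<^sup>2 * inner_h g (map_mat double_well U) (grid_one g)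
     + \<beta> / 2 * (norm_h g (laplace_h g U))\<^sup>2"

end

theory Submission
  imports Defs
begin

text \<open>
  Since \<open>D\<^sub>x\<close> and \<open>D\<^sub>y\<close> are skew-symmetric, the discrete Laplacian is self-adjoint and negative
  semidefinite. The update of \<open>Q\<close> telescopes, so that \<open>Q = (U \<odot> U - 1) / 2\<close> also holds at the new
  time level and \<open>F(U) = Q \<odot> Q\<close> entrywise at both levels. Hence the energy increment equals
  \<open>(\<mu>, U\<^sup>n\<^sup>+\<^sup>1 - U\<^sup>n)\<^sub>h = \<Delta>t (\<mu>, \<Delta>\<^sub>h \<mu>)\<^sub>h \<le> 0\<close>.
\<close>

section \<open>Skew-symmetry of the Fourier differentiation matrices\<close>

text \<open>Swapping the indices changes the sign of the argument of \<open>cot\<close>, which is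
  odd, while the factor with exponent \<open>j + l\<close> is symmetric and the diagonal
  vanishes.\<close>

lemma transpose_fourier_diff: "(fourier_diff L N)\<^sup>T = - fourier_diff L N"
proof (rule eq_matI)
  fix i j assume "i < dim_row (- fourier_diff L N)" "j < dim_col (- fourier_diff L N)"
  then have ij: "i < N" "j < N" by (auto simp: fourier_diff_def)
  have "pi * (real j - real i) / real N = - (pi * (real i - real j) / real N)"
    by (simp add: minus_divide_left algebra_simps)
  then have "cot (pi * (real j - real i) / real N) = - cot (pi * (real i - real j) / real N)"
    by (simp only: cot_minus)
  with ij show "(fourier_diff L N)\<^sup>T $$ (i, j) = (- fourier_diff L N) $$ (i, j)"
    by (simp add: fourier_diff_def add.commute)
qed (auto simp: fourier_diff_def)

lemma fourier_diff_carrier [simp]: "fourier_diff L N \<in> carrier_mat N N"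
  by (simp add: fourier_diff_def)

lemma Dx_carrier [simp]: "Dx g \<in> carrier_mat (xnum g) (xnum g)"
  by (simp add: Dx_def)

lemma Dy_carrier [simp]: "Dy g \<in> carrier_mat (ynum g) (ynum g)"
  by (simp add: Dy_def)

section \<open>The discrete Laplacian as a linear operator on grid functions\<close>

lemma pow_mat_two: "A \<in> carrier_mat n n \<Longrightarrow> A ^\<^sub>m 2 = A * A"
  by (simp add: numeral_2_eq_2)

text \<open>The two signs from transposing \<open>Dy g\<close> cancel in the square. Bracketing as
  repeated single applications lets one factor at a time be moved across the inner product.\<close>

lemma laplace_h_eq:
  assumes "U \<in> grid_functions g"
  shows "laplace_h g U = Dx g * (Dx g * U) + (U * Dy g) * Dy g"
proof -
  have U: "U \<in> carrier_mat (xnum g) (ynum g)"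
    using assms by (simp add: grid_functions_def)
  have "(Dy g)\<^sup>T * (Dy g)\<^sup>T = Dy g * Dy g"
    unfolding Dy_def transpose_fourier_diff by (simp add: fourier_diff_def)
  then have "(Dy g)\<^sup>T ^\<^sub>m 2 = Dy g * Dy g"
    by (simp add: pow_mat_two[of _ "ynum g"])
  then show ?thesis
    by (simp add: laplace_h_def pow_mat_two[OF Dx_carrier] assoc_mult_mat[OF Dx_carrier Dx_carrier U]
        assoc_mult_mat[OF U Dy_carrier Dy_carrier])
qed

lemma grid_functions_closed2 [simp]:
  assumes "U \<in> grid_functions g" "V \<in> grid_functions g"
  shows "U + V \<in> grid_functions g" "U - V \<in> grid_functions g" "U \<odot> V \<in> grid_functions g"
  using assms by (auto simp: grid_functions_def hadamard_def)

lemma grid_functions_closed [simp]: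
  assumes "U \<in> grid_functions g"
  shows "- U \<in> grid_functions g" "c \<cdot>\<^sub>m U \<in> grid_functions g"
    "Dx g * U \<in> grid_functions g" "U * Dy g \<in> grid_functions g"
  using assms
  by (auto simp: grid_functions_def
      intro: mult_carrier_mat[OF Dx_carrier] mult_carrier_mat[OF _ Dy_carrier])

lemma laplace_h_closed [simp]: "U \<in> grid_functions g \<Longrightarrow> laplace_h g U \<in> grid_functions g"
  by (simp add: laplace_h_eq)

text \<open>Follows from the distributive laws of matrix multiplication. Together with additivity
  and homogeneity it splits the Laplacians of the increment and of the midpoint into those at the
  two time levels.\<close>

lemma laplace_h_diff:
  assumes "U \<in> grid_functions g" "V \<in> grid_functions g"
  shows "laplace_h g (U - V) = laplace_h g U - laplace_h g V"
proof -
  have U: "U \<in> carrier_mat (xnum g) (ynum g)" "Dx g * U \<in> carrier_mat (xnum g) (ynum g)"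
      "U * Dy g \<in> carrier_mat (xnum g) (ynum g)"
    and V: "V \<in> carrier_mat (xnum g) (ynum g)" "Dx g * V \<in> carrier_mat (xnum g) (ynum g)"
      "V * Dy g \<in> carrier_mat (xnum g) (ynum g)"
    using assms grid_functions_closed[OF assms(1)] grid_functions_closed[OF assms(2)]
    by (simp_all add: grid_functions_def)
  have "laplace_h g (U - V) = (Dx g * (Dx g * U) - Dx g * (Dx g * V))
      + ((U * Dy g) * Dy g - (V * Dy g) * Dy g)"
    using assms U V
    by (simp add: laplace_h_eq mult_minus_distrib_mat[OF Dx_carrier]
        minus_mult_distrib_mat[OF U(1) V(1) Dy_carrier]
        minus_mult_distrib_mat[OF U(3) V(3) Dy_carrier])
  also have "\<dots> = laplace_h g U - laplace_h g V"
  proof -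
    \<comment> \<open>Matrix addition can be regrouped freely only when the dimensions match, so the
      identity is checked entrywise for matrices on the same grid.\<close>
    have "(A - B) + (C - D) = (A + C) - (B + D)"
      if "A \<in> grid_functions g" "B \<in> grid_functions g" "C \<in> grid_functions g" "D \<in> grid_functions g"
      for A B C D
      using that by (intro eq_matI) (auto simp: grid_functions_def)
    then show ?thesis
      unfolding laplace_h_eq[OF assms(1)] laplace_h_eq[OF assms(2)]
      by (rule) (simp_all add: assms)
  qed
  finally show ?thesis .
qed

lemma laplace_h_add:
  assumes "U \<in> grid_functions g" "V \<in> grid_functions g"
  shows "laplace_h g (U + V) = laplace_h g U + laplace_h g V"
proof -
  have U: "U \<in> carrier_mat (xnum g) (ynum g)" "Dx g * U \<in> carrier_mat (xnum g) (ynum g)"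
      "U * Dy g \<in> carrier_mat (xnum g) (ynum g)"
    and V: "V \<in> carrier_mat (xnum g) (ynum g)" "Dx g * V \<in> carrier_mat (xnum g) (ynum g)"
      "V * Dy g \<in> carrier_mat (xnum g) (ynum g)"
    using assms grid_functions_closed[OF assms(1)] grid_functions_closed[OF assms(2)]
    by (simp_all add: grid_functions_def)
  have "laplace_h g (U + V) = (Dx g * (Dx g * U) + Dx g * (Dx g * V))
      + ((U * Dy g) * Dy g + (V * Dy g) * Dy g)"
    using assms U V
    by (simp add: laplace_h_eq mult_add_distrib_mat[OF Dx_carrier]
        add_mult_distrib_mat[OF U(1) V(1) Dy_carrier]
        add_mult_distrib_mat[OF U(3) V(3) Dy_carrier])
  also have "\<dots> = laplace_h g U + laplace_h g V"
  proof -
    have "(A + B) + (C + D) = (A + C) + (B + D)"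
      if "A \<in> grid_functions g" "B \<in> grid_functions g" "C \<in> grid_functions g" "D \<in> grid_functions g"
      for A B C D
      using that by (intro eq_matI) (auto simp: grid_functions_def)
    then show ?thesis
      unfolding laplace_h_eq[OF assms(1)] laplace_h_eq[OF assms(2)]
      by (rule) (simp_all add: assms)
  qed
  finally show ?thesis .
qed

lemma laplace_h_smult:
  assumes "U \<in> grid_functions g"
  shows "laplace_h g (c \<cdot>\<^sub>m U) = c \<cdot>\<^sub>m laplace_h g U"
proof -
  have U: "U \<in> carrier_mat (xnum g) (ynum g)" "Dx g * U \<in> carrier_mat (xnum g) (ynum g)"
      "U * Dy g \<in> carrier_mat (xnum g) (ynum g)"
    using assms grid_functions_closed[OF assms] by (simp_all add: grid_functions_def)
  have "laplace_h g (c \<cdot>\<^sub>m U) = c \<cdot>\<^sub>m (Dx g * (Dx g * U)) + c \<cdot>\<^sub>m ((U * Dy g) * Dy g)"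
    using assms U
    by (simp add: laplace_h_eq mult_smult_distrib[OF Dx_carrier] mult_smult_assoc_mat[OF U(1) Dy_carrier]
        mult_smult_assoc_mat[OF U(3) Dy_carrier])
  also have "\<dots> = c \<cdot>\<^sub>m laplace_h g U"
    using assms add_smult_distrib_left_mat[of "Dx g * (Dx g * U)" "xnum g" "ynum g" "(U * Dy g) * Dy g" c]
      grid_functions_closed[of "Dx g * U" g] grid_functions_closed[of "U * Dy g" g]
    by (simp add: laplace_h_eq grid_functions_def[symmetric])
  finally show ?thesis .
qed

section \<open>The discrete inner product\<close>

lemma inner_h_commute: "inner_h g U V = inner_h g V U"
  by (simp add: inner_h_def mult.commute)

lemma inner_h_add_left:
  assumes "U \<in> grid_functions g" "V \<in> grid_functions g"
  shows "inner_h g (U + V) W = inner_h g U W + inner_h g V W"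
  using assms
  by (simp add: inner_h_def grid_functions_def distrib_right distrib_left sum.distrib)

lemma inner_h_diff_left:
  assumes "U \<in> grid_functions g" "V \<in> grid_functions g"
  shows "inner_h g (U - V) W = inner_h g U W - inner_h g V W"
  using assms
  by (simp add: inner_h_def grid_functions_def left_diff_distrib right_diff_distrib sum_subtractf)

lemma inner_h_smult_left:
  assumes "U \<in> grid_functions g"
  shows "inner_h g (c \<cdot>\<^sub>m U) W = c * inner_h g U W"
  using assms
  by (simp add: inner_h_def grid_functions_def sum_distrib_left mult_ac)

lemma inner_h_uminus_left:
  assumes "U \<in> grid_functions g"
  shows "inner_h g (- U) W = - inner_h g U W"
  using assms
  by (simp add: inner_h_def grid_functions_def sum_negf)

lemma inner_h_diff_right:
  assumes "U \<in> grid_functions g" "V \<in> grid_functions g"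
  shows "inner_h g W (U - V) = inner_h g W U - inner_h g W V"
  using inner_h_diff_left[OF assms] by (simp add: inner_h_commute)

text \<open>On a valid grid both mesh widths are nonnegative, and the double sum consists of
  squares.\<close>

lemma inner_h_self_nonneg:
  assumes "valid_grid g"
  shows "inner_h g U U \<ge> 0"
proof -
  have "hx g \<ge> 0" "hy g \<ge> 0"
    using assms by (simp_all add: valid_grid_def hx_def hy_def)
  then show ?thesis
    unfolding inner_h_def by (intro mult_nonneg_nonneg sum_nonneg zero_le_square) auto
qed

lemma norm_h_power2: "valid_grid g \<Longrightarrow> (norm_h g U)\<^sup>2 = inner_h g U U"
  by (simp add: norm_h_def inner_h_self_nonneg)

section \<open>Summation by parts and the sign of the Laplacian\<close>

text \<open>Discrete integration by parts in x: the sign comes from the skew-symmetry of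
  \<open>Dx g\<close>, and periodicity leaves no boundary terms.\<close>

lemma inner_h_Dx:
  assumes "U \<in> grid_functions g" "V \<in> grid_functions g"
  shows "inner_h g (Dx g * U) V = - inner_h g U (Dx g * V)"
proof -
  have skew: "Dx g $$ (j, i) = - Dx g $$ (i, j)" if "i < xnum g" "j < xnum g" for i j
  proof -
    have "(Dx g)\<^sup>T $$ (i, j) = (- Dx g) $$ (i, j)"
      by (simp add: Dx_def transpose_fourier_diff)
    with that show ?thesis using Dx_carrier[of g] by simp
  qed
  have L: "(Dx g * W) $$ (j, k) = (\<Sum>i<xnum g. Dx g $$ (j, i) * W $$ (i, k))"
    if "W \<in> grid_functions g" "j < xnum g" "k < ynum g" for W j k
    using that carrier_matD[OF Dx_carrier[of g]]
    by (auto simp: grid_functions_def scalar_prod_def lessThan_atLeast0 intro!: sum.cong)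
  have "(\<Sum>j<xnum g. \<Sum>k<ynum g. (Dx g * U) $$ (j, k) * V $$ (j, k))
      = (\<Sum>j<xnum g. \<Sum>k<ynum g. \<Sum>i<xnum g. Dx g $$ (j, i) * U $$ (i, k) * V $$ (j, k))"
    using assms by (simp add: L sum_distrib_right)
  \<comment> \<open>Three adjacent swaps take the summation order from j, k, i to i, k, j, so that
    the innermost sum becomes a row of \<open>Dx g\<close> applied to a column of
    \<open>V\<close>.\<close>
  also have "\<dots> = (\<Sum>k<ynum g. \<Sum>j<xnum g. \<Sum>i<xnum g. Dx g $$ (j, i) * U $$ (i, k) * V $$ (j, k))"
    by (rule sum.swap)
  also have "\<dots> = (\<Sum>k<ynum g. \<Sum>i<xnum g. \<Sum>j<xnum g. Dx g $$ (j, i) * U $$ (i, k) * V $$ (j, k))"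
    by (intro sum.cong refl sum.swap)
  also have "\<dots> = (\<Sum>i<xnum g. \<Sum>k<ynum g. \<Sum>j<xnum g. Dx g $$ (j, i) * U $$ (i, k) * V $$ (j, k))"
    by (rule sum.swap)
  also have "\<dots> = (\<Sum>i<xnum g. \<Sum>k<ynum g. \<Sum>j<xnum g. - (U $$ (i, k) * (Dx g $$ (i, j) * V $$ (j, k))))"
  proof (intro sum.cong refl)
    fix i k j assume "i \<in> {..<xnum g}" "j \<in> {..<xnum g}"
    then show "Dx g $$ (j, i) * U $$ (i, k) * V $$ (j, k) = - (U $$ (i, k) * (Dx g $$ (i, j) * V $$ (j, k)))"
      using skew[of i j] by simp
  qed
  also have "\<dots> = - (\<Sum>i<xnum g. \<Sum>k<ynum g. U $$ (i, k) * (Dx g * V) $$ (i, k))"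
    using assms by (simp add: L sum_distrib_left sum_negf)
  finally show ?thesis
    by (simp add: inner_h_def)
qed

text \<open>The counterpart in y. Since \<open>Dy g\<close> acts from the right, the row index
  \<open>j\<close> is a spectator and a single swap of the two inner sums is enough.\<close>

lemma inner_h_Dy:
  assumes "U \<in> grid_functions g" "V \<in> grid_functions g"
  shows "inner_h g (U * Dy g) V = - inner_h g U (V * Dy g)"
proof -
  have skew: "Dy g $$ (j, i) = - Dy g $$ (i, j)" if "i < ynum g" "j < ynum g" for i j
  proof -
    have "(Dy g)\<^sup>T $$ (i, j) = (- Dy g) $$ (i, j)"
      by (simp add: Dy_def transpose_fourier_diff)
    with that show ?thesis using Dy_carrier[of g] by simp
  qed
  have R: "(W * Dy g) $$ (j, k) = (\<Sum>i<ynum g. W $$ (j, i) * Dy g $$ (i, k))"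
    if "W \<in> grid_functions g" "j < xnum g" "k < ynum g" for W j k
    using that carrier_matD[OF Dy_carrier[of g]]
    by (auto simp: grid_functions_def scalar_prod_def lessThan_atLeast0 intro!: sum.cong)
  have "(\<Sum>j<xnum g. \<Sum>k<ynum g. (U * Dy g) $$ (j, k) * V $$ (j, k))
      = (\<Sum>j<xnum g. \<Sum>k<ynum g. \<Sum>i<ynum g. U $$ (j, i) * Dy g $$ (i, k) * V $$ (j, k))"
    using assms by (simp add: R sum_distrib_right)
  also have "\<dots> = (\<Sum>j<xnum g. \<Sum>i<ynum g. \<Sum>k<ynum g. U $$ (j, i) * Dy g $$ (i, k) * V $$ (j, k))"
    by (intro sum.cong refl sum.swap)
  also have "\<dots> = (\<Sum>j<xnum g. \<Sum>i<ynum g. \<Sum>k<ynum g. - (U $$ (j, i) * (V $$ (j, k) * Dy g $$ (k, i))))"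
  proof (intro sum.cong refl)
    fix j i k assume "i \<in> {..<ynum g}" "k \<in> {..<ynum g}"
    then show "U $$ (j, i) * Dy g $$ (i, k) * V $$ (j, k) = - (U $$ (j, i) * (V $$ (j, k) * Dy g $$ (k, i)))"
      using skew[of k i] by simp
  qed
  also have "\<dots> = - (\<Sum>j<xnum g. \<Sum>i<ynum g. U $$ (j, i) * (V * Dy g) $$ (j, i))"
    using assms by (simp add: R sum_distrib_left sum_negf)
  finally show ?thesis
    by (simp add: inner_h_def)
qed

text \<open>A discrete Green formula, obtained by moving one of the two derivatives in each
  direction to \<open>V\<close>. Its right-hand side is symmetric, which gives self-adjointness, and
  for \<open>V = U\<close> it is minus a sum of squared norms.\<close>

lemma inner_h_laplace_h:
  assumes "U \<in> grid_functions g" "V \<in> grid_functions g"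
  shows "inner_h g (laplace_h g U) V
    = - inner_h g (Dx g * U) (Dx g * V) - inner_h g (U * Dy g) (V * Dy g)"
  using assms by (simp add: laplace_h_eq inner_h_add_left inner_h_Dx inner_h_Dy)

lemma inner_h_laplace_h_commute:
  assumes "U \<in> grid_functions g" "V \<in> grid_functions g"
  shows "inner_h g (laplace_h g U) V = inner_h g U (laplace_h g V)"
  unfolding inner_h_commute[of g U] inner_h_laplace_h[OF assms] inner_h_laplace_h[OF assms(2,1)]
  by (simp add: inner_h_commute)

lemma inner_h_laplace_h_self_nonpos:
  assumes "valid_grid g" "U \<in> grid_functions g"
  shows "inner_h g (laplace_h g U) U \<le> 0"
  using inner_h_self_nonneg[OF assms(1), of "Dx g * U"] inner_h_self_nonneg[OF assms(1), of "U * Dy g"]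
  by (simp add: inner_h_laplace_h[OF assms(2,2)])

section \<open>Energy dissipation of the scheme\<close>

theorem theorem3p1:
  fixes g :: grid
    and \<epsilon> \<beta> dt :: real
    and U Q :: "nat \<Rightarrow> real mat"
    and n :: nat
    and \<mu> :: "real mat"
  assumes "valid_grid g"
    and "\<epsilon> > 0" and "\<beta> \<ge> 0" and "dt > 0"
    and "U n \<in> grid_functions g" and "U (n + 1) \<in> grid_functions g"
    and "Q n \<in> grid_functions g" and "Q (n + 1) \<in> grid_functions g"
    and "\<mu> \<in> grid_functions g"
    and "delta_t dt U n = laplace_h g \<mu>"
    and "\<mu> = - laplace_h g (midpoint U n)
             + (2 / \<epsilon>\<^sup>2) \<cdot>\<^sub>m (midpoint U n \<odot> midpoint Q n)
             + \<beta> \<cdot>\<^sub>m laplace_h g (laplace_h g (midpoint U n))"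
    and "delta_t dt Q n = midpoint U n \<odot> delta_t dt U n"
    and "Q n = (1 / 2) \<cdot>\<^sub>m (U n \<odot> U n - grid_one g)"
  shows "energy_iso_h g \<epsilon> \<beta> (U (n + 1)) \<le> energy_iso_h g \<epsilon> \<beta> (U n)"
proof -
  define U0 U1 Q0 Q1 where "U0 = U n" and "U1 = U (n + 1)" and "Q0 = Q n" and "Q1 = Q (n + 1)"
  define m p d where "m = midpoint U n" and "p = midpoint Q n" and "d = U1 - U0"
  have G [simp]: "U0 \<in> grid_functions g" "U1 \<in> grid_functions g" "Q0 \<in> grid_functions g"
      "Q1 \<in> grid_functions g" "\<mu> \<in> grid_functions g"
    using assms(5-9) by (simp_all add: U0_def U1_def Q0_def Q1_def)
  have m_eq: "m = (1 / 2) \<cdot>\<^sub>m (U1 + U0)" and p_eq: "p = (1 / 2) \<cdot>\<^sub>m (Q1 + Q0)"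
    by (simp_all add: m_def p_def U0_def U1_def Q0_def Q1_def midpoint_def)
  have G' [simp]: "m \<in> grid_functions g" "p \<in> grid_functions g" "d \<in> grid_functions g"
    by (simp_all add: m_eq p_eq d_def)
  have C: "U0 \<in> carrier_mat (xnum g) (ynum g)" "U1 \<in> carrier_mat (xnum g) (ynum g)"
      "Q0 \<in> carrier_mat (xnum g) (ynum g)" "Q1 \<in> carrier_mat (xnum g) (ynum g)"
    using G unfolding grid_functions_def by auto
  have d_eq: "d = dt \<cdot>\<^sub>m laplace_h g \<mu>"
    unfolding assms(10)[symmetric]
    using C assms(4) by (intro eq_matI) (auto simp: delta_t_def d_def U0_def U1_def)

  have well: "inner_h g (map_mat double_well U1) (grid_one g) - inner_h g (map_mat double_well U0) (grid_one g)
      = 2 * inner_h g (m \<odot> p) d"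
  proof -
    \<comment> \<open>At each node the well energy is the square of \<open>Q\<close>, and the
      difference of squares factors into \<open>Q1 + Q0\<close>, twice the midpoint
      \<open>p\<close>, and \<open>Q1 - Q0\<close>, which the scheme makes equal to \<open>m\<close>
      times \<open>d\<close>.\<close>
    have pt: "double_well (U1 $$ (j, k)) - double_well (U0 $$ (j, k))
        = 2 * ((m \<odot> p) $$ (j, k) * d $$ (j, k))"
      if "j < xnum g" "k < ynum g" for j k
    proof -
      have q0: "Q0 $$ (j, k) = ((U0 $$ (j, k))\<^sup>2 - 1) / 2"
        using C that arg_cong[OF assms(13), of "\<lambda>A. A $$ (j, k)"]
        by (simp add: Q0_def U0_def hadamard_def grid_one_def power2_eq_square)
      have "(Q1 $$ (j, k) - Q0 $$ (j, k)) / dt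
          = (U1 $$ (j, k) + U0 $$ (j, k)) / 2 * ((U1 $$ (j, k) - U0 $$ (j, k)) / dt)"
        using C that arg_cong[OF assms(12), of "\<lambda>A. A $$ (j, k)"]
        by (simp add: Q0_def Q1_def U0_def U1_def hadamard_def delta_t_def midpoint_def)
      \<comment> \<open>Cancelling the common denominator leaves the alternative
        \<open>dt = 0\<close>, excluded by the positive time step.\<close>
      then have dq: "Q1 $$ (j, k) - Q0 $$ (j, k)
          = (U1 $$ (j, k) + U0 $$ (j, k)) / 2 * (U1 $$ (j, k) - U0 $$ (j, k))"
        using assms(4) unfolding times_divide_eq_right divide_cancel_right by (elim disjE) simp_all
      \<comment> \<open>The right-hand side of \<open>dq\<close> is half the difference of the
        squares of \<open>U1\<close> and \<open>U0\<close>. The relation defining \<open>Q0\<close>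
        is thus inherited by \<open>Q1\<close>, so the original quartic energy is controlled and not
        merely a modified quadratic one.\<close>
      have q1: "Q1 $$ (j, k) = ((U1 $$ (j, k))\<^sup>2 - 1) / 2"
        using dq q0 by (simp add: field_simps power2_eq_square)
      have "double_well (U1 $$ (j, k)) - double_well (U0 $$ (j, k)) = (Q1 $$ (j, k))\<^sup>2 - (Q0 $$ (j, k))\<^sup>2"
        by (simp add: q0 q1 double_well_def power_divide)
      also have "\<dots> = (Q1 $$ (j, k) + Q0 $$ (j, k)) * (Q1 $$ (j, k) - Q0 $$ (j, k))"
        by (simp add: power2_eq_square algebra_simps)
      also have "\<dots> = 2 * ((m \<odot> p) $$ (j, k) * d $$ (j, k))"
        unfolding dq using C that by (simp add: m_eq p_eq d_def hadamard_def)
      finally show ?thesis .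
    qed
    have one: "inner_h g (map_mat double_well V) (grid_one g)
        = hx g * hy g * (\<Sum>j<xnum g. \<Sum>k<ynum g. double_well (V $$ (j, k)))"
      if "V \<in> carrier_mat (xnum g) (ynum g)" for V
      using that by (simp add: inner_h_def grid_one_def)
    show ?thesis
      unfolding one[OF C(1)] one[OF C(2)] right_diff_distrib[symmetric] sum_subtractf[symmetric]
      by (simp add: pt inner_h_def sum_distrib_left mult_ac)
  qed

  \<comment> \<open>Polarization: expanding the pairing of the Laplacian of \<open>U1 + U0\<close>
    with \<open>U1 - U0\<close>, the cross terms cancel by self-adjointness. The factor 2 offsets
    the half in the midpoint.\<close>
  have quadratic: "inner_h g (laplace_h g U1) U1 - inner_h g (laplace_h g U0) U0
      = 2 * inner_h g (laplace_h g m) d"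
    using inner_h_laplace_h_commute[OF G(1,2)] inner_h_commute[of g U0 "laplace_h g U1"]
    by (simp add: m_eq d_def laplace_h_smult laplace_h_add inner_h_smult_left inner_h_add_left
        inner_h_diff_right algebra_simps)

  \<comment> \<open>Moving the outer Laplacian onto \<open>d\<close> reduces this to the difference
    of two squared norms, where the cross terms cancel by symmetry of the inner product.\<close>
  have biharmonic: "(norm_h g (laplace_h g U1))\<^sup>2 - (norm_h g (laplace_h g U0))\<^sup>2
      = 2 * inner_h g (laplace_h g (laplace_h g m)) d"
    using inner_h_commute[of g "laplace_h g U0" "laplace_h g U1"]
    by (simp add: norm_h_power2[OF assms(1)] inner_h_laplace_h_commute m_eq d_def laplace_h_smult
        laplace_h_add laplace_h_diff inner_h_smult_left inner_h_add_left inner_h_diff_right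
        algebra_simps)

  have "inner_h g \<mu> d = - inner_h g (laplace_h g m) d + 2 / \<epsilon>\<^sup>2 * inner_h g (m \<odot> p) d
      + \<beta> * inner_h g (laplace_h g (laplace_h g m)) d"
    by (subst assms(11)) (simp add: m_def[symmetric] p_def[symmetric] inner_h_add_left
        inner_h_smult_left inner_h_uminus_left)
  moreover have "energy_iso_h g \<epsilon> \<beta> U1 - energy_iso_h g \<epsilon> \<beta> U0
      = - (1 / 2) * (inner_h g (laplace_h g U1) U1 - inner_h g (laplace_h g U0) U0)
      + 1 / \<epsilon>\<^sup>2 * (inner_h g (map_mat double_well U1) (grid_one g)
          - inner_h g (map_mat double_well U0) (grid_one g))
      + \<beta> / 2 * ((norm_h g (laplace_h g U1))\<^sup>2 - (norm_h g (laplace_h g U0))\<^sup>2)"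
    unfolding energy_iso_h_def right_diff_distrib by linarith
  \<comment> \<open>The factor 2 in each of the three identities turns the energy weights into
    exactly the coefficients of the three terms of \<open>\<mu>\<close>.\<close>
  ultimately have "energy_iso_h g \<epsilon> \<beta> U1 - energy_iso_h g \<epsilon> \<beta> U0 = inner_h g \<mu> d"
    unfolding well quadratic biharmonic by simp
  also have "\<dots> = dt * inner_h g (laplace_h g \<mu>) \<mu>"
    by (subst inner_h_commute) (simp add: d_eq inner_h_smult_left)
  also have "\<dots> \<le> 0"
    using assms(4) inner_h_laplace_h_self_nonpos[OF assms(1) G(5)] by (simp add: mult_nonneg_nonpos)
  finally show ?thesis
    by (simp add: U0_def U1_def)
qed

end
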